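(* Let $(\Omega,T,\mu)$ be an invertible dynamical system. If there exists $F\in AC(\Omega,T,\mu)$ such that the Shannon entropy $Se(F,T)$ of the process $(F\circ T^n)$ is finite, then $(\Omega,T,\mu)$ has infinite Kolmogorov–Sinai entropy.
   Context: An invertible dynamical system $(\Omega,T,\mu)$ is a probability space $(\Omega,\mu)$ with an invertible measure-preserving transformation $T$. $AC(\Omega,T,\mu)$ denotes the set of real-valued $F\in L^2(\mu)$ such that for every $n\ge 1$ the law $\mu F_n^{-1}$ of $F_n:=(F,F\circ T,\dots,F\circ T^{n-1})$ is absolutely continuous with respect to Lebesgue measure $l^n$ on $\mathbb R^n$. With $\psi(x)=-x\log x$, $\psi(0)=0$, set $H_n(F):=\int_{\mathbb R^n}\psi\left(\frac{d\mu F_n^{-1}}{dl^n}\right)dl^n\in[-\infty,\infty)$. The Shannon entropy is $Se(F,T):=\lim_n\frac1nH_n(F)$, which exists in $[-\infty,\infty)$. *)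

theory Defs
  imports "HOL-Probability.Probability"
begin

locale invertible_dynamical_system = prob_space M for M :: "'a measure" +
  fixes T :: "'a \<Rightarrow> 'a"
  assumes measurable_T: "T \<in> M \<rightarrow>\<^sub>M M"
    and bij_T: "bij_betw T (space M) (space M)"
    and measurable_inv_T: "the_inv_into (space M) T \<in> M \<rightarrow>\<^sub>M M"
    and measure_preserving_T: "distr M M T = M"

definition psi :: "real \<Rightarrow> real" where
  "psi x = (if x = 0 then 0 else - x * ln x)"

text \<open>Points of the \<open>n\<close>-dimensional space are extensional functions on \<open>{..<n}\<close>, because \<open>n\<close>
  varies inside the definitions below; the measure is Lebesgue measure on the Borel sets.\<close>

definition lebesgue_pow :: "nat \<Rightarrow> (nat \<Rightarrow> real) measure" where
  "lebesgue_pow n = (\<Pi>\<^sub>M i\<in>{..<n}. lborel)"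

definition orbit_vec :: "('a \<Rightarrow> 'a) \<Rightarrow> ('a \<Rightarrow> real) \<Rightarrow> nat \<Rightarrow> 'a \<Rightarrow> nat \<Rightarrow> real" where
  "orbit_vec T F n \<omega> = (\<lambda>i\<in>{..<n}. F ((T ^^ i) \<omega>))"

definition orbit_law :: "'a measure \<Rightarrow> ('a \<Rightarrow> 'a) \<Rightarrow> ('a \<Rightarrow> real) \<Rightarrow> nat \<Rightarrow> (nat \<Rightarrow> real) measure" where
  "orbit_law M T F n = distr M (lebesgue_pow n) (orbit_vec T F n)"

definition AC :: "'a measure \<Rightarrow> ('a \<Rightarrow> 'a) \<Rightarrow> ('a \<Rightarrow> real) set" where
  "AC M T = {F. F \<in> borel_measurable M \<and> integrable M (\<lambda>\<omega>. (F \<omega>)\<^sup>2) \<and>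
     (\<forall>n\<ge>1. absolutely_continuous (lebesgue_pow n) (orbit_law M T F n))}"

text \<open>The integral of the positive part minus that of the negative part. In \<open>ereal\<close> the difference
  \<open>\<infinity> - \<infinity>\<close> is \<open>\<infinity>\<close>; it does not arise for entropies of square-integrable \<open>F\<close>, whose positive part
  is integrable.\<close>

definition ext_integral :: "'b measure \<Rightarrow> ('b \<Rightarrow> real) \<Rightarrow> ereal" where
  "ext_integral N g = enn2ereal (\<integral>\<^sup>+ x. ennreal (g x) \<partial>N) - enn2ereal (\<integral>\<^sup>+ x. ennreal (- g x) \<partial>N)"

definition diff_entropy :: "'a measure \<Rightarrow> ('a \<Rightarrow> 'a) \<Rightarrow> ('a \<Rightarrow> real) \<Rightarrow> nat \<Rightarrow> ereal" where
  "diff_entropy M T F n = ext_integral (lebesgue_pow n)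
     (\<lambda>x. psi (enn2real (RN_deriv (lebesgue_pow n) (orbit_law M T F n) x)))"

definition shannon_entropy :: "'a measure \<Rightarrow> ('a \<Rightarrow> 'a) \<Rightarrow> ('a \<Rightarrow> real) \<Rightarrow> ereal" where
  "shannon_entropy M T F = lim (\<lambda>n. diff_entropy M T F n / ereal (real n))"

definition finite_measurable_partition :: "'a measure \<Rightarrow> 'a set set \<Rightarrow> bool" where
  "finite_measurable_partition M P \<longleftrightarrow> finite P \<and> P \<subseteq> sets M \<and> partition_on (space M) P"

definition partition_entropy :: "'a measure \<Rightarrow> 'a set set \<Rightarrow> real" where
  "partition_entropy M P = (\<Sum>A\<in>P. psi (measure M A))"

definition preimage_partition :: "'a measure \<Rightarrow> ('a \<Rightarrow> 'a) \<Rightarrow> 'a set set \<Rightarrow> 'a set set" where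
  "preimage_partition M S P = (\<lambda>A. S -` A \<inter> space M) ` P"

text \<open>\<open>common_refinement\<close> takes the set of partitions to be joined, so coinciding preimage partitions
  are identified; this is harmless because joining is idempotent. The value at \<open>n = 0\<close> is
  meaningless and does not affect the limit below.\<close>

definition iterated_join :: "'a measure \<Rightarrow> ('a \<Rightarrow> 'a) \<Rightarrow> 'a set set \<Rightarrow> nat \<Rightarrow> 'a set set" where
  "iterated_join M T P n = common_refinement ((\<lambda>i. preimage_partition M (T ^^ i) P) ` {..<n})"

definition partition_entropy_rate :: "'a measure \<Rightarrow> ('a \<Rightarrow> 'a) \<Rightarrow> 'a set set \<Rightarrow> ereal" where
  "partition_entropy_rate M T P =
     lim (\<lambda>n. ereal (partition_entropy M (iterated_join M T P n) / real n))"

definition kolmogorov_sinai_entropy :: "'a measure \<Rightarrow> ('a \<Rightarrow> 'a) \<Rightarrow> ereal" where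
  "kolmogorov_sinai_entropy M T =
     (SUP P \<in> {P. finite_measurable_partition M P}. partition_entropy_rate M T P)"

end

(*
  Partition the real line into the tail |x| >= N, where P(|F| < N) >= 1/2, and cells of width 1/k
  covering the rest, and let w be the function equal to k on the cells and to the standard Gaussian
  density on the tail. On the n-dimensional space, giving each product of cells its probability under
  the law of (F, F o T, ..., F o T^(n-1)) and spreading it inside by w yields a subprobability density
  G. Gibbs' inequality against G bounds the differential entropy by H_n - n E[ln w(F)], where H_n is the
  entropy of the n-fold join of the induced finite partition of the space. As
  E[ln w(F)] >= (ln k)/2 - C with C independent of k, the entropy rate of that partition is at least
  (ln k)/2 plus a constant, hence unbounded in k. Finiteness of the Shannon entropy only enters by
  excluding that the differential entropies per step tend to minus infinity.
*)

theory Submission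
  imports Defs
begin

subsection \<open>Itineraries and joins of partitions\<close>

text \<open>A finite partition is coded by a label function \<open>c\<close>; the itinerary of
  length \<open>n\<close> then labels the block of the \<open>n\<close>-fold join. The restriction
  to \<open>{..<n}\<close> makes equality of itineraries mean agreement at the first
  \<open>n\<close> times.\<close>

definition itinerary :: "('a \<Rightarrow> 'a) \<Rightarrow> ('a \<Rightarrow> 'b) \<Rightarrow> nat \<Rightarrow> 'a \<Rightarrow> nat \<Rightarrow> 'b" where
  "itinerary T c n \<omega> = (\<lambda>i\<in>{..<n}. c ((T ^^ i) \<omega>))"

definition level_sets :: "'a measure \<Rightarrow> ('a \<Rightarrow> 'b) \<Rightarrow> 'a set set" where
  "level_sets M X = (\<lambda>x. X -` {x} \<inter> space M) ` (X ` space M)"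

definition level_entropy :: "'a measure \<Rightarrow> ('a \<Rightarrow> 'b) \<Rightarrow> real" where
  "level_entropy M X = (\<Sum>x\<in>X ` space M. psi (measure M (X -` {x} \<inter> space M)))"

lemma itinerary_eq_iff:
  "itinerary T c n \<omega> = itinerary T c n \<omega>' \<longleftrightarrow> (\<forall>i<n. c ((T ^^ i) \<omega>) = c ((T ^^ i) \<omega>'))"
  by (auto simp: itinerary_def fun_eq_iff)

lemma itinerary_zero: "itinerary T c 0 \<omega> = (\<lambda>_. undefined)"
  by (simp add: itinerary_def restrict_def)

lemma itinerary_add_eq_iff:
  "itinerary T c (m + n) \<omega> = itinerary T c (m + n) \<omega>' \<longleftrightarrow>
   itinerary T c m \<omega> = itinerary T c m \<omega>' \<and>
   itinerary T c n ((T ^^ m) \<omega>) = itinerary T c n ((T ^^ m) \<omega>')"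
proof -
  have "(\<forall>i<m + n. P i) \<longleftrightarrow> (\<forall>i<m. P i) \<and> (\<forall>i<n. P (i + m))" for P
  proof safe
    fix i assume "\<forall>i<m. P i" "\<forall>i<n. P (i + m)" "i < m + n"
    then show "P i"
      by (cases "i < m") (auto dest: spec[of _ "i - m"])
  qed auto
  then show ?thesis
    unfolding itinerary_eq_iff by (simp add: funpow_add)
qed

lemma partition_entropy_level_sets: "partition_entropy M (level_sets M X) = level_entropy M X"
  unfolding partition_entropy_def level_sets_def level_entropy_def
  by (subst sum.reindex) (auto simp: inj_on_def)

lemma partition_on_level_sets: "partition_on (space M) (level_sets M X)"
  by (rule partition_onI) (auto simp: level_sets_def disjnt_def)

lemma mem_level_sets_iff:
  "A \<in> level_sets M X \<longleftrightarrow> (\<exists>\<omega>\<in>space M. A = {\<omega>'\<in>space M. X \<omega>' = X \<omega>})"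
  by (auto simp: level_sets_def)

text \<open>Entropy sees only the fibres, not the labels. This lets a pair of shorter itineraries
  replace one of length \<open>m + n\<close> without a bijection between their ranges.\<close>

lemma level_entropy_cong_kernel:
  assumes "\<And>\<omega> \<omega>'. \<omega> \<in> space M \<Longrightarrow> \<omega>' \<in> space M \<Longrightarrow> X \<omega> = X \<omega>' \<longleftrightarrow> Y \<omega> = Y \<omega>'"
  shows "level_entropy M X = level_entropy M Y"
proof -
  have "level_sets M X = level_sets M Y"
    unfolding level_sets_def image_image using assms by (intro image_cong) auto
  then show ?thesis
    by (metis partition_entropy_level_sets)
qed

text \<open>Both sides consist of the sets obtained by intersecting, over the times
  \<open>i < n\<close>, the blocks that contain a common point \<open>\<omega>\<close>. For
  \<open>n = 0\<close> the refinement would intersect an empty family.\<close>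

lemma iterated_join_level_sets:
  assumes T: "T \<in> space M \<rightarrow> space M" and "n > 0"
  shows "iterated_join M T (level_sets M c) n = level_sets M (itinerary T c n)"
proof -
  let ?Q = "\<lambda>i. preimage_partition M (T ^^ i) (level_sets M c)"
  have Ti: "(T ^^ i) \<omega> \<in> space M" if "\<omega> \<in> space M" for i \<omega>
    using that T by (induction i) auto
  define L where "L i \<omega> = {\<omega>'\<in>space M. c ((T ^^ i) \<omega>') = c ((T ^^ i) \<omega>)}" for i \<omega>
  have L_in: "L i \<omega> \<in> ?Q i" if "\<omega> \<in> space M" for i \<omega>
    using Ti[OF that] Ti by (auto simp: preimage_partition_def level_sets_def L_def image_iff)
  have L_unique: "B = L i \<omega>" if "B \<in> ?Q i" "\<omega> \<in> B" for B i \<omega>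
    using that Ti by (auto simp: preimage_partition_def level_sets_def L_def)
  have Q_space: "B \<subseteq> space M" if "B \<in> ?Q i" for B i
    using that by (auto simp: preimage_partition_def)
  have Int_L: "(\<Inter>i<n. L i \<omega>) = {\<omega>'\<in>space M. itinerary T c n \<omega>' = itinerary T c n \<omega>}" for \<omega>
    using \<open>n > 0\<close> by (auto simp: L_def itinerary_eq_iff)
  show ?thesis
  proof (intro set_eqI iffI)
    fix A assume "A \<in> iterated_join M T (level_sets M c) n"
    then obtain g \<omega> where g: "\<And>i. i < n \<Longrightarrow> g (?Q i) \<in> ?Q i" and A: "A = (\<Inter>i<n. g (?Q i))"
      and \<omega>: "\<omega> \<in> A"
      unfolding iterated_join_def common_refinement by (auto simp: Pi_iff image_image)
    have "g (?Q i) = L i \<omega>" if "i < n" for i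
      using L_unique[OF g[OF that]] \<omega> A that by auto
    then have "A = (\<Inter>i<n. L i \<omega>)"
      using A by simp
    moreover have "\<omega> \<in> space M"
      using Q_space[OF g[OF \<open>n > 0\<close>]] \<omega> \<open>n > 0\<close> unfolding A by blast
    ultimately show "A \<in> level_sets M (itinerary T c n)"
      using Int_L by (auto simp: mem_level_sets_iff)
  next
    fix A assume "A \<in> level_sets M (itinerary T c n)"
    then obtain \<omega> where \<omega>: "\<omega> \<in> space M" and A: "A = (\<Inter>i<n. L i \<omega>)"
      unfolding mem_level_sets_iff Int_L by auto
    \<comment> \<open>A selector in \<open>common_refinement\<close> is indexed by partitions, and
      the \<open>?Q i\<close> may coincide for different \<open>i\<close>. The block through
      \<open>\<omega>\<close> depends on the partition alone, so this choice is consistent.\<close>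
    define g where "g Q = (THE B. B \<in> Q \<and> \<omega> \<in> B)" for Q
    have g: "g (?Q i) = L i \<omega>" for i
      unfolding g_def
    proof (rule the_equality)
      show "L i \<omega> \<in> ?Q i \<and> \<omega> \<in> L i \<omega>"
        using L_in \<omega> by (auto simp: L_def)
    qed (use L_unique in blast)
    have "g \<in> (\<Pi> Q\<in>?Q ` {..<n}. Q)"
      using g L_in[OF \<omega>] by auto
    moreover have "A = \<Inter> (g ` ?Q ` {..<n})"
      using A g by (simp add: image_image)
    moreover have "\<omega> \<in> A"
      using \<omega> A by (auto simp: L_def)
    ultimately show "A \<in> iterated_join M T (level_sets M c) n"
      unfolding iterated_join_def common_refinement by blast
  qed
qed

subsection \<open>Entropy rates of finite partitions\<close>

text \<open>Fekete's lemma: the limit is the infimum \<open>L\<close> over \<open>n \<ge> 1\<close>,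
  finite by nonnegativity. Dividing \<open>n\<close> with remainder by a near-optimal
  \<open>m\<close> gives the upper bound.\<close>

lemma fekete_nonneg:
  fixes a :: "nat \<Rightarrow> real"
  assumes nonneg: "\<And>n. 0 \<le> a n" and subadd: "\<And>m n. a (m + n) \<le> a m + a n"
  shows "convergent (\<lambda>n. a n / n)"
proof -
  define L where "L = (INF n\<in>{1..}. a n / n)"
  have bdd: "bdd_below ((\<lambda>n. a n / n) ` {1..})"
    using nonneg by (intro bdd_belowI[of _ 0]) auto
  have lower: "L \<le> a n / n" if "n \<ge> 1" for n
    unfolding L_def using bdd that by (intro cINF_lower) auto
  have mult: "a (q * m + r) \<le> q * a m + a r" for q m r
  proof (induction q)
    case (Suc q)
    have "a (Suc q * m + r) \<le> a m + a (q * m + r)"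
      using subadd[of m "q * m + r"] by (simp add: add.assoc)
    with Suc show ?case by (simp add: algebra_simps)
  qed simp
  have "(\<lambda>n. a n / n) \<longlonglongrightarrow> L"
  proof (rule order_tendstoI)
    fix x assume "x < L"
    then show "\<forall>\<^sub>F n in sequentially. x < a n / n"
      using lower by (intro eventually_sequentiallyI[of 1]) (auto intro: less_le_trans)
  next
    fix x assume "L < x"
    then obtain m where m: "m \<ge> 1" "a m / m < x"
      using cINF_less_iff[OF _ bdd, of x] unfolding L_def by auto
    \<comment> \<open>One bound for all remainder terms \<open>a (n mod m)\<close>; divided by
      \<open>n\<close> it vanishes.\<close>
    define C where "C = (\<Sum>r<m. a r)"
    have C: "a r \<le> C" if "r < m" for r
      unfolding C_def using that nonneg by (intro member_le_sum) auto
    have upper: "a n / n \<le> a m / m + C / n" if "n \<ge> 1" for n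
    proof -
      have "a n \<le> (n div m) * a m + a (n mod m)"
        using mult[of "n div m" m "n mod m"] by simp
      also have "\<dots> \<le> (n / m) * a m + C"
        using m nonneg C by (intro add_mono mult_right_mono) (auto simp: of_nat_div_le_of_nat)
      finally show ?thesis
        using that by (simp add: field_simps)
    qed
    have "(\<lambda>n. a m / m + C / n) \<longlonglongrightarrow> a m / m + 0"
      by (intro tendsto_intros lim_const_over_n)
    then have "\<forall>\<^sub>F n in sequentially. a m / m + C / n < x"
      using m by (intro order_tendstoD) auto
    then show "\<forall>\<^sub>F n in sequentially. a n / n < x"
      using eventually_ge_at_top[of 1] by eventually_elim (rule le_less_trans[OF upper])
  qed
  then show ?thesis
    by (rule convergentI)
qed

section \<open>Shannon entropy of simple functions\<close>

lemma psi_nonneg: "0 \<le> x \<Longrightarrow> x \<le> 1 \<Longrightarrow> 0 \<le> psi x"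
  by (cases "x = 0") (auto simp: psi_def mult_nonneg_nonpos)

lemma (in prob_space) level_entropy_nonneg: "0 \<le> level_entropy M X"
  unfolding level_entropy_def by (intro sum_nonneg psi_nonneg) auto

lemma (in information_space) entropy_eq_level_entropy:
  assumes X: "simple_function M X"
  shows "\<H>(X) = level_entropy M X / ln b"
  unfolding entropy_simple_distributed[OF simple_distributedI[OF X measure_nonneg refl]]
    level_entropy_def sum_divide_distrib sum_negf[symmetric]
  by (intro sum.cong) (auto simp: psi_def log_def)

text \<open>Chain rule, together with the fact that conditioning does not increase entropy. In base
  \<open>exp 1\<close> the information-theoretic entropy agrees with
  \<open>level_entropy\<close>.\<close>

lemma (in prob_space) level_entropy_subadditive:
  assumes X: "simple_function M X" and Y: "simple_function M Y"
  shows "level_entropy M (\<lambda>\<omega>. (X \<omega>, Y \<omega>)) \<le> level_entropy M X + level_entropy M Y"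
proof -
  interpret information_space M "exp 1"
    by unfold_locales simp
  show ?thesis
    using entropy_chain_rule[OF X Y] conditional_entropy_less_eq_entropy[OF Y X]
    by (simp add: entropy_eq_level_entropy X Y)
qed

section \<open>Itinerary entropies under the invariant measure\<close>

context invertible_dynamical_system
begin

lemma measurable_funpow_T [measurable]: "T ^^ i \<in> M \<rightarrow>\<^sub>M M"
  by (induction i) (simp_all add: measurable_comp[OF _ measurable_T] del: o_apply flip: id_def)

lemma distr_funpow_T: "distr M M (T ^^ i) = M"
proof (induction i)
  case 0
  then show ?case by (simp add: id_def)
next
  case (Suc i)
  have "distr M M (T ^^ Suc i) = distr (distr M M (T ^^ i)) M T"
    by (subst distr_distr) (simp_all add: measurable_T)
  then show ?case
    by (metis Suc measure_preserving_T)
qed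

lemma image_funpow_T: "(T ^^ i) ` space M = space M"
  using bij_betw_funpow[OF bij_T] by (simp add: bij_betw_imp_surj_on)

text \<open>Invariance preserves the fibre probabilities, and surjectivity of \<open>T\<close> keeps
  the range, so both sums have the same index set.\<close>

lemma level_entropy_comp_funpow_T:
  assumes X: "simple_function M X"
  shows "level_entropy M (\<lambda>\<omega>. X ((T ^^ i) \<omega>)) = level_entropy M X"
proof -
  have range: "(\<lambda>\<omega>. X ((T ^^ i) \<omega>)) ` space M = X ` space M"
    using image_funpow_T[of i] by (metis image_image)
  have "measure M ((\<lambda>\<omega>. X ((T ^^ i) \<omega>)) -` {x} \<inter> space M) = measure M (X -` {x} \<inter> space M)" for x
  proof -
    have "measure M (X -` {x} \<inter> space M) = measure (distr M M (T ^^ i)) (X -` {x} \<inter> space M)"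
      by (simp add: distr_funpow_T)
    also have "\<dots> = measure M ((T ^^ i) -` (X -` {x} \<inter> space M) \<inter> space M)"
      by (intro measure_distr simple_functionD[OF X]) simp
    also have "(T ^^ i) -` (X -` {x} \<inter> space M) \<inter> space M = (\<lambda>\<omega>. X ((T ^^ i) \<omega>)) -` {x} \<inter> space M"
      using image_funpow_T[of i] by auto
    finally show ?thesis by simp
  qed
  then show ?thesis
    by (simp add: level_entropy_def range)
qed

lemma simple_function_comp_funpow_T:
  assumes "simple_function M X"
  shows "simple_function M (\<lambda>\<omega>. X ((T ^^ i) \<omega>))"
  unfolding simple_function_eq_measurable
proof
  have "(\<lambda>\<omega>. X ((T ^^ i) \<omega>)) ` space M = X ` space M"
    using image_funpow_T[of i] by (metis image_image)
  then show "finite ((\<lambda>\<omega>. X ((T ^^ i) \<omega>)) ` space M)"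
    using simple_functionD(1)[OF assms] by simp
  show "(\<lambda>\<omega>. X ((T ^^ i) \<omega>)) \<in> M \<rightarrow>\<^sub>M count_space UNIV"
    by (rule measurable_compose[OF measurable_funpow_T measurable_simple_function[OF assms]])
qed

lemma simple_function_itinerary:
  assumes c: "simple_function M c"
  shows "simple_function M (itinerary T c n)"
proof (induction n)
  case 0
  then show ?case by (simp add: itinerary_zero[abs_def])
next
  case (Suc n)
  have "itinerary T c (Suc n) = (\<lambda>\<omega>. (itinerary T c n \<omega>)(n := c ((T ^^ n) \<omega>)))"
    by (auto simp: itinerary_def fun_eq_iff)
  then show ?case
    using simple_function_compose2[OF Suc simple_function_comp_funpow_T[OF c, of n],
        where h = "\<lambda>f x. f(n := x)"]
    by (simp only:)
qed

text \<open>The last \<open>n\<close> coordinates form an itinerary of length \<open>n\<close>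
  started at time \<open>m\<close>; by invariance its entropy is that of one started at time
  0.\<close>

lemma itinerary_entropy_subadditive:
  assumes c: "simple_function M c"
  shows "level_entropy M (itinerary T c (m + n)) \<le>
         level_entropy M (itinerary T c m) + level_entropy M (itinerary T c n)"
proof -
  let ?Y = "\<lambda>\<omega>. itinerary T c n ((T ^^ m) \<omega>)"
  have "level_entropy M (itinerary T c (m + n)) = level_entropy M (\<lambda>\<omega>. (itinerary T c m \<omega>, ?Y \<omega>))"
    by (rule level_entropy_cong_kernel) (simp add: itinerary_add_eq_iff)
  also have "\<dots> \<le> level_entropy M (itinerary T c m) + level_entropy M ?Y"
    by (intro level_entropy_subadditive simple_function_comp_funpow_T simple_function_itinerary c)
  also have "level_entropy M ?Y = level_entropy M (itinerary T c n)"
    by (intro level_entropy_comp_funpow_T simple_function_itinerary c)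
  finally show ?thesis .
qed

lemma finite_measurable_partition_level_sets:
  assumes "simple_function M c"
  shows "finite_measurable_partition M (level_sets M c)"
  using simple_functionD[OF assms] partition_on_level_sets[of M c]
  by (auto simp: finite_measurable_partition_def level_sets_def)

text \<open>The rate is defined by \<open>lim\<close>, which is informative only for a convergent
  sequence; subadditivity of the itinerary entropies supplies the convergence.\<close>

lemma partition_entropy_rate_level_sets:
  assumes c: "simple_function M c"
  shows "(\<lambda>n. ereal (level_entropy M (itinerary T c n) / n))
           \<longlonglongrightarrow> partition_entropy_rate M T (level_sets M c)"
proof -
  let ?h = "\<lambda>n. level_entropy M (itinerary T c n)"
  obtain L where L: "(\<lambda>n. ?h n / n) \<longlonglongrightarrow> L"
    using fekete_nonneg[of ?h] level_entropy_nonneg itinerary_entropy_subadditive[OF c]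
    by (auto simp: convergent_def)
  have T: "T \<in> space M \<rightarrow> space M"
    using measurable_T by (auto dest: measurable_space)
  have "\<forall>\<^sub>F n in sequentially. ?h n / n = partition_entropy M (iterated_join M T (level_sets M c) n) / n"
    using eventually_gt_at_top[of 0]
    by eventually_elim (simp add: iterated_join_level_sets[OF T] partition_entropy_level_sets)
  with L have "(\<lambda>n. partition_entropy M (iterated_join M T (level_sets M c) n) / n) \<longlonglongrightarrow> L"
    by (rule Lim_transform_eventually)
  then have "partition_entropy_rate M T (level_sets M c) = ereal L"
    unfolding partition_entropy_rate_def by (intro limI tendsto_ereal)
  then show ?thesis
    using L by simp
qed

end

subsection \<open>A Gibbs inequality for the differential entropy\<close>

text \<open>Compares positive and negative parts separately. Both parts of \<open>u\<close> have
  finite integral, so no difference of infinities occurs; the integral of \<open>g\<close> may still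
  be minus infinity.\<close>

lemma ext_integral_le:
  assumes u: "integrable N u" and le: "AE x in N. g x \<le> u x"
  shows "ext_integral N g \<le> ereal (integral\<^sup>L N u)"
proof -
  let ?p = "\<integral>\<^sup>+ x. ennreal (u x) \<partial>N" and ?m = "\<integral>\<^sup>+ x. ennreal (- u x) \<partial>N"
  have fin: "?p \<noteq> \<infinity>" "?m \<noteq> \<infinity>"
    using u by (auto simp: real_integrable_def)
  have "(\<integral>\<^sup>+ x. ennreal (g x) \<partial>N) \<le> ?p" "?m \<le> (\<integral>\<^sup>+ x. ennreal (- g x) \<partial>N)"
    using le by (auto intro!: nn_integral_mono_AE ennreal_leI)
  then have "ext_integral N g \<le> enn2ereal ?p - enn2ereal ?m"
    unfolding ext_integral_def by (intro ereal_minus_mono) (auto simp: less_eq_ennreal.rep_eq)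
  also have "\<dots> = ereal (enn2real ?p) - ereal (enn2real ?m)"
    using fin by (cases ?p; cases ?m) (auto simp: enn2ereal_ennreal)
  also have "\<dots> = ereal (integral\<^sup>L N u)"
    by (simp add: real_lebesgue_integral_def[OF u])
  finally show ?thesis .
qed

text \<open>Pointwise Gibbs inequality: \<open>ln t \<le> t - 1\<close> at \<open>t = q / p\<close>,
  multiplied by \<open>p\<close>. The third hypothesis excludes \<open>q = 0 < p\<close>, where
  \<open>ln q\<close> is a mere default value.\<close>

lemma psi_le_tangent:
  assumes "0 \<le> p" "0 \<le> q" "p > 0 \<Longrightarrow> q > 0"
  shows "psi p \<le> - p * ln q + (q - p)"
proof (cases "p = 0")
  case False
  with assms have pos: "p > 0" "q > 0" by auto
  then have "p * (ln q - ln p) \<le> p * (q / p - 1)"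
    by (intro mult_left_mono) (use ln_le_minus_one[of "q / p"] in \<open>auto simp: ln_div\<close>)
  with pos show ?thesis
    by (simp add: psi_def algebra_simps)
qed (use assms in \<open>auto simp: psi_def\<close>)

text \<open>\<open>- ln (p (X \<omega>))\<close> is the information of the block containing
  \<open>\<omega>\<close>, and its mean is the entropy. There are finitely many blocks, so those of
  probability zero together form a null set.\<close>

lemma (in prob_space) integral_ln_level_probability:
  assumes X: "simple_function M X"
  defines "p \<equiv> \<lambda>a. measure M (X -` {a} \<inter> space M)"
  shows "integrable M (\<lambda>\<omega>. ln (p (X \<omega>)))"
    and "(\<integral>\<omega>. ln (p (X \<omega>)) \<partial>M) = - level_entropy M X"
    and "AE \<omega> in M. p (X \<omega>) > 0"
proof -
  note S = simple_functionD[OF X]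
  have eq: "ln (p (X \<omega>)) = (\<Sum>a\<in>X ` space M. ln (p a) * indicator (X -` {a} \<inter> space M) \<omega>)"
    if "\<omega> \<in> space M" for \<omega>
    using that S(1) by (subst sum.remove[of _ "X \<omega>"]) (auto simp: indicator_def intro!: sum.neutral)
  have int: "integrable M (\<lambda>\<omega>. \<Sum>a\<in>X ` space M. ln (p a) * indicator (X -` {a} \<inter> space M) \<omega>)"
    using S by (intro Bochner_Integration.integrable_sum integrable_mult_right)
      (auto simp: emeasure_eq_measure)
  then show "integrable M (\<lambda>\<omega>. ln (p (X \<omega>)))"
    by (subst Bochner_Integration.integrable_cong[OF refl eq])
  have "(\<integral>\<omega>. ln (p (X \<omega>)) \<partial>M) =
      (\<integral>\<omega>. (\<Sum>a\<in>X ` space M. ln (p a) * indicator (X -` {a} \<inter> space M) \<omega>) \<partial>M)"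
    by (intro Bochner_Integration.integral_cong refl eq)
  also have "\<dots> = (\<Sum>a\<in>X ` space M. ln (p a) * p a)"
    using S by (subst Bochner_Integration.integral_sum)
      (auto simp: p_def emeasure_eq_measure Int_absorb2 intro!: integrable_mult_right)
  also have "\<dots> = - level_entropy M X"
    unfolding level_entropy_def sum_negf[symmetric] p_def by (intro sum.cong) (auto simp: psi_def)
  finally show "(\<integral>\<omega>. ln (p (X \<omega>)) \<partial>M) = - level_entropy M X" .
  have "AE \<omega> in M. p a = 0 \<longrightarrow> X \<omega> \<noteq> a" for a
  proof (cases "p a = 0")
    case True
    then have "AE \<omega> in M. \<omega> \<notin> X -` {a} \<inter> space M"
      using prob_eq_0[OF S(2)] by (simp add: p_def)
    then show ?thesis
      by (rule AE_mp) auto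
  qed simp
  then have "AE \<omega> in M. \<forall>a\<in>X ` space M. p a = 0 \<longrightarrow> X \<omega> \<noteq> a"
    by (intro AE_finite_allI S)
  then show "AE \<omega> in M. p (X \<omega>) > 0"
    using AE_space by eventually_elim (metis imageI less_le measure_nonneg p_def)
qed

section \<open>Comparison of orbit laws with product densities on boxes of cells\<close>

lemma sigma_finite_lebesgue_pow: "sigma_finite_measure (lebesgue_pow n)"
proof -
  interpret product_sigma_finite "\<lambda>_::nat. lborel :: real measure"
    by unfold_locales
  show ?thesis
    unfolding lebesgue_pow_def by (rule sigma_finite) simp
qed

lemma (in invertible_dynamical_system) measurable_orbit_vec:
  assumes [measurable]: "F \<in> borel_measurable M"
  shows "orbit_vec T F n \<in> M \<rightarrow>\<^sub>M lebesgue_pow n"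
  unfolding orbit_vec_def[abs_def] lebesgue_pow_def by measurable

text \<open>Gibbs' inequality for the density \<open>f\<close> of the orbit law against
  \<open>G\<close>. Along orbits \<open>ln G\<close> splits into the log-probability of the
  itinerary, with mean minus its entropy, and \<open>n\<close> terms \<open>ln w\<close> of equal
  mean.\<close>

lemma (in invertible_dynamical_system) diff_entropy_le:
  assumes ac: "absolutely_continuous (lebesgue_pow n) (orbit_law M T F n)"
    and F [measurable]: "F \<in> borel_measurable M"
    and cell: "cell \<in> borel \<rightarrow>\<^sub>M count_space UNIV" "finite (range cell)"
    and w [measurable]: "w \<in> borel_measurable borel" and w_pos: "\<And>x. 0 < w x"
    and w_cell: "\<And>j. (\<integral>\<^sup>+ x. ennreal (w x * indicator {x. cell x = j} x) \<partial>lborel) \<le> 1"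
    and int_w: "integrable M (\<lambda>\<omega>. ln (w (F \<omega>)))"
  shows "diff_entropy M T F n \<le>
    ereal (level_entropy M (itinerary T (\<lambda>\<omega>. cell (F \<omega>)) n) - n * (\<integral>\<omega>. ln (w (F \<omega>)) \<partial>M))"
proof -
  let ?L = "lebesgue_pow n" and ?N = "orbit_law M T F n" and ?V = "orbit_vec T F n"
  define X where "X = itinerary T (\<lambda>\<omega>. cell (F \<omega>)) n"
  define p where "p a = measure M (X -` {a} \<inter> space M)" for a
  define f where "f x = enn2real (RN_deriv ?L ?N x)" for x
  define G where "G x = (\<Sum>a\<in>X ` space M. p a * (\<Prod>i<n. w (x i) * indicator {y. cell y = a i} (x i)))" for x
  interpret L: sigma_finite_measure ?L
    by (rule sigma_finite_lebesgue_pow)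
  interpret lb: product_sigma_finite "\<lambda>_::nat. lborel :: real measure"
    by unfold_locales
  have [measurable]: "{y. cell y = j} \<in> sets borel" for j
    using measurable_sets[OF cell(1), of "{j}"] by (simp add: vimage_def)
  have V [measurable]: "?V \<in> M \<rightarrow>\<^sub>M ?L"
    by (rule measurable_orbit_vec[OF F])
  have N_sets: "sets ?N = sets ?L"
    by (simp add: orbit_law_def)
  interpret N: prob_space ?N
    unfolding orbit_law_def by (rule prob_space_distr[OF V])
  have "simple_function M (\<lambda>\<omega>. cell (F \<omega>))"
    unfolding simple_function_eq_measurable
    using finite_subset[OF _ cell(2)] measurable_compose[OF F cell(1)] by (auto simp: image_subset_iff)
  then have X: "simple_function M X"
    unfolding X_def by (rule simple_function_itinerary)
  note S = simple_functionD(1)[OF X]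
  note X_int = integral_ln_level_probability[OF X, folded p_def]

  have f_meas [measurable]: "f \<in> borel_measurable ?L"
    unfolding f_def by measurable
  have f_nonneg: "0 \<le> f x" for x
    by (simp add: f_def)
  \<comment> \<open>Passing to real values loses nothing: the law is sigma-finite, so its derivative
    is finite almost everywhere.\<close>
  have f_density: "density ?L f = ?N"
  proof -
    have "density ?L f = density ?L (RN_deriv ?L ?N)"
      using L.RN_deriv_finite[OF N.sigma_finite_measure_axioms ac N_sets]
      by (intro density_cong) (auto simp: f_def less_top[symmetric])
    then show ?thesis
      by (simp add: L.density_RN_deriv[OF ac N_sets])
  qed
  have f_int: "integrable ?L f" and f_integral: "integral\<^sup>L ?L f = 1"
  proof -
    have "integrable ?N (\<lambda>_. 1::real)" "integral\<^sup>L ?N (\<lambda>_. 1::real) = 1"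
      by (simp_all add: N.prob_space)
    then show "integrable ?L f" "integral\<^sup>L ?L f = 1"
      using integrable_real_density[OF f_meas, of "\<lambda>_. 1"] integral_real_density[OF f_meas, of "\<lambda>_. 1"]
      by (simp_all add: f_density f_nonneg)
  qed

  have G_meas [measurable]: "G \<in> borel_measurable ?L"
    unfolding G_def lebesgue_pow_def by measurable
  have p_nonneg: "0 \<le> p a" for a
    by (simp add: p_def)
  have G_nonneg: "0 \<le> G x" for x
    unfolding G_def using w_pos by (intro sum_nonneg mult_nonneg_nonneg prod_nonneg p_nonneg) (auto simp: less_imp_le)
  \<comment> \<open>By Tonelli the integral over each box is a product of \<open>n\<close> factors,
    each at most 1 by \<open>w_cell\<close>; the weights \<open>p a\<close> are probabilities of
    disjoint fibres.\<close>
  have "(\<integral>\<^sup>+ x. ennreal (G x) \<partial>?L) \<le> 1"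
  proof -
    have factor: "ennreal (p a * (\<Prod>i<n. w (x i) * indicator {y. cell y = a i} (x i))) =
        ennreal (p a) * (\<Prod>i<n. ennreal (w (x i) * indicator {y. cell y = a i} (x i)))" for a x
      using w_pos by (subst prod_ennreal) (auto simp: less_imp_le ennreal_mult' p_nonneg)
    have G_eq: "ennreal (G x) = (\<Sum>a\<in>X ` space M. ennreal (p a) *
        (\<Prod>i<n. ennreal (w (x i) * indicator {y. cell y = a i} (x i))))" for x
      unfolding G_def factor[symmetric] using w_pos
      by (intro sum_ennreal[symmetric] mult_nonneg_nonneg prod_nonneg p_nonneg) (auto simp: less_imp_le)
    have "(\<integral>\<^sup>+ x. ennreal (G x) \<partial>?L) = (\<Sum>a\<in>X ` space M. ennreal (p a) *
        (\<integral>\<^sup>+ x. (\<Prod>i<n. ennreal (w (x i) * indicator {y. cell y = a i} (x i))) \<partial>?L))"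
      unfolding G_eq lebesgue_pow_def
      by (subst nn_integral_sum) (auto intro!: sum.cong nn_integral_cmult)
    also have "\<dots> = (\<Sum>a\<in>X ` space M. ennreal (p a) *
        (\<Prod>i<n. \<integral>\<^sup>+ y. ennreal (w y * indicator {y. cell y = a i} y) \<partial>lborel))"
      unfolding lebesgue_pow_def
      by (intro sum.cong refl arg_cong2[where f = "(*)"] lb.product_nn_integral_prod) auto
    also have "\<dots> \<le> (\<Sum>a\<in>X ` space M. ennreal (p a) * 1)"
      using w_cell by (intro sum_mono mult_left_mono prod_le_1) auto
    also have "\<dots> = ennreal (\<Sum>a\<in>X ` space M. p a)"
      by (simp add: p_nonneg)
    also have "(\<Sum>a\<in>X ` space M. p a) = measure M (\<Union>a\<in>X ` space M. X -` {a} \<inter> space M)"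
      unfolding p_def by (intro finite_measure_finite_Union[symmetric] S)
        (auto simp: simple_functionD[OF X] disjoint_family_on_def)
    finally show ?thesis
      by (simp add: order_trans)
  qed
  then have G_int: "integrable ?L G" and G_integral: "integral\<^sup>L ?L G \<le> 1"
    using G_nonneg
    by (auto intro!: integrableI_nonneg integral_real_bounded simp: less_top[symmetric] top_unique)

  \<comment> \<open>An orbit vector lies only in the box of its own itinerary, so the sum defining
    \<open>G\<close> collapses.\<close>
  have G_V: "G (?V \<omega>) = p (X \<omega>) * (\<Prod>i<n. w (F ((T ^^ i) \<omega>)))" if \<omega>: "\<omega> \<in> space M" for \<omega>
  proof -
    have "(\<Prod>i<n. w (?V \<omega> i) * indicator {y. cell y = a i} (?V \<omega> i)) =
        (if a = X \<omega> then \<Prod>i<n. w (F ((T ^^ i) \<omega>)) else 0)" if "a \<in> X ` space M" for a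
    proof (cases "a = X \<omega>")
      case True
      then show ?thesis
        by (auto simp: X_def itinerary_def orbit_vec_def intro!: prod.cong)
    next
      case False
      with that obtain i where "i < n" "cell (F ((T ^^ i) \<omega>)) \<noteq> a i"
        unfolding X_def by (auto simp: itinerary_eq_iff) (auto simp: itinerary_def)
      with False show ?thesis
        by (auto simp: orbit_vec_def intro!: bexI[of _ i])
    qed
    then have "G (?V \<omega>) = (\<Sum>a\<in>X ` space M. if a = X \<omega> then p a * (\<Prod>i<n. w (F ((T ^^ i) \<omega>))) else 0)"
      unfolding G_def by (intro sum.cong) auto
    then show ?thesis
      using S \<omega> by simp
  qed
  let ?lnG = "\<lambda>\<omega>. ln (p (X \<omega>)) + (\<Sum>i<n. ln (w (F ((T ^^ i) \<omega>))))"
  \<comment> \<open>The logarithm of the product splits where \<open>p (X \<omega>) > 0\<close>,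
    hence almost everywhere.\<close>
  have G_pos_V: "AE \<omega> in M. 0 < G (?V \<omega>)" and ln_G_V: "AE \<omega> in M. ?lnG \<omega> = ln (G (?V \<omega>))"
    using X_int(3) AE_space
    by (eventually_elim, simp add: G_V w_pos prod_pos ln_mult ln_prod less_imp_neq[symmetric])+
  have shift: "integrable M (\<lambda>\<omega>. ln (w (F ((T ^^ i) \<omega>))))"
    "(\<integral>\<omega>. ln (w (F ((T ^^ i) \<omega>))) \<partial>M) = (\<integral>\<omega>. ln (w (F \<omega>)) \<partial>M)" for i
    using int_w integrable_distr_eq[of "T ^^ i" M M "\<lambda>\<omega>. ln (w (F \<omega>))"]
      integral_distr[of "T ^^ i" M M "\<lambda>\<omega>. ln (w (F \<omega>))"]
    by (simp_all add: distr_funpow_T)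
  have lnG_int: "integrable M ?lnG" and lnG_integral:
      "integral\<^sup>L M ?lnG = - level_entropy M X + n * (\<integral>\<omega>. ln (w (F \<omega>)) \<partial>M)"
    using X_int(1,2) shift by simp_all
  have ln_G_meas: "(\<lambda>\<omega>. ln (G (?V \<omega>))) \<in> borel_measurable M"
    by measurable
  have "integrable M (\<lambda>\<omega>. ln (G (?V \<omega>)))"
    by (rule integrable_cong_AE_imp[OF lnG_int ln_G_meas ln_G_V])
  moreover have "(\<integral>\<omega>. ln (G (?V \<omega>)) \<partial>M) = - level_entropy M X + n * (\<integral>\<omega>. ln (w (F \<omega>)) \<partial>M)"
    using integral_cong_AE[OF borel_measurable_integrable[OF lnG_int] ln_G_meas ln_G_V] lnG_integral
    by (rule trans[OF sym])
  ultimately have "integrable ?N (\<lambda>x. ln (G x))"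
    and "integral\<^sup>L ?N (\<lambda>x. ln (G x)) = - level_entropy M X + n * (\<integral>\<omega>. ln (w (F \<omega>)) \<partial>M)"
    unfolding orbit_law_def by (simp_all add: integrable_distr_eq integral_distr)
  then have fG_int: "integrable ?L (\<lambda>x. f x * ln (G x))"
    and fG_integral: "(\<integral>x. f x * ln (G x) \<partial>?L) = - level_entropy M X + n * (\<integral>\<omega>. ln (w (F \<omega>)) \<partial>M)"
    using integrable_real_density[OF f_meas, of "\<lambda>x. ln (G x)"]
      integral_real_density[OF f_meas, of "\<lambda>x. ln (G x)"]
    by (simp_all add: f_density f_nonneg)

  \<comment> \<open>Positivity of \<open>G\<close> along almost all orbits passes to the law, and
    from there to almost every point with \<open>f x > 0\<close>, the side condition of
    \<open>psi_le_tangent\<close>.\<close>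
  have "AE x in ?N. 0 < G x"
    unfolding orbit_law_def using G_pos_V by (subst AE_distr_iff) auto
  then have "AE x in ?L. 0 < f x \<longrightarrow> 0 < G x"
    unfolding f_density[symmetric] by (simp add: AE_density)
  then have "AE x in ?L. psi (f x) \<le> - (f x * ln (G x)) + (G x - f x)"
    by eventually_elim (use psi_le_tangent[OF f_nonneg G_nonneg] in force)
  then have "diff_entropy M T F n \<le> ereal (\<integral>x. - (f x * ln (G x)) + (G x - f x) \<partial>?L)"
    unfolding diff_entropy_def f_def[symmetric] using fG_int G_int f_int
    by (intro ext_integral_le) auto
  \<comment> \<open>The correction \<open>G - f\<close> integrates to at most 0, as \<open>f\<close>
    has mass 1 and \<open>G\<close> at most 1.\<close>
  also have "\<dots> \<le> ereal (level_entropy M X - n * (\<integral>\<omega>. ln (w (F \<omega>)) \<partial>M))"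
    using fG_int G_int f_int fG_integral f_integral G_integral by simp
  finally show ?thesis
    unfolding X_def .
qed

text \<open>If no real bound held infinitely often, the sequence would tend to minus infinity.
  Infinitely many \<open>n\<close> suffice later because the partition entropies per step
  converge.\<close>

lemma (in invertible_dynamical_system) frequently_diff_entropy_ge:
  assumes "\<bar>shannon_entropy M T F\<bar> \<noteq> \<infinity>"
  obtains r where "\<exists>\<^sub>F n in sequentially. ereal r \<le> diff_entropy M T F n / ereal (real n)"
proof -
  have "\<not> (\<forall>r. \<forall>\<^sub>F n in sequentially. diff_entropy M T F n / ereal (real n) < ereal r)"
  proof
    assume "\<forall>r. \<forall>\<^sub>F n in sequentially. diff_entropy M T F n / ereal (real n) < ereal r"
    then have "shannon_entropy M T F = - \<infinity>"
      unfolding shannon_entropy_def by (intro limI) (simp add: tendsto_MInfty)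
    with assms show False by simp
  qed
  with that show ?thesis
    by (auto simp: frequently_def not_le)
qed

text \<open>The events increase to the whole space. Fixing \<open>N\<close> before the cell width
  keeps at least half of the mass in short cells, however short they become.\<close>

lemma (in prob_space) prob_abs_less_ge_half:
  assumes [measurable]: "F \<in> borel_measurable M"
  obtains N :: real where "1 / 2 \<le> prob {\<omega>\<in>space M. \<bar>F \<omega>\<bar> < N}"
proof -
  let ?A = "\<lambda>n::nat. {\<omega>\<in>space M. \<bar>F \<omega>\<bar> < real n}"
  have "(\<lambda>n. prob (?A n)) \<longlonglongrightarrow> prob (\<Union>n. ?A n)"
    by (rule finite_Lim_measure_incseq) (auto simp: incseq_def)
  also have "(\<Union>n. ?A n) = space M"
    using reals_Archimedean2 by auto
  finally have "\<forall>\<^sub>F n in sequentially. 1 / 2 < prob (?A n)"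
    by (intro order_tendstoD) (auto simp: prob_space)
  then show ?thesis
    using that by (auto simp: eventually_sequentially intro: less_imp_le)
qed

subsection \<open>Partitions of the line into short cells\<close>

text \<open>\<open>None\<close> labels the tail. For \<open>k > 0\<close> every other cell is part
  of an interval of length \<open>1 / k\<close>.\<close>

definition cell :: "real \<Rightarrow> real \<Rightarrow> real \<Rightarrow> int option" where
  "cell N k x = (if \<bar>x\<bar> < N then Some \<lfloor>k * x\<rfloor> else None)"

text \<open>The height \<open>k\<close> compensates for the cell width. The Gaussian tail has a
  quadratic logarithm, which is integrable along a square-integrable \<open>F\<close>.\<close>

definition cell_density :: "real \<Rightarrow> real \<Rightarrow> real \<Rightarrow> real" where
  "cell_density N k x = (if \<bar>x\<bar> < N then k else std_normal_density x)"

lemma measurable_cell [measurable]: "cell N k \<in> borel \<rightarrow>\<^sub>M count_space UNIV"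
  unfolding cell_def[abs_def] by measurable

lemma finite_range_cell: "finite (range (cell N k))"
proof (rule finite_subset)
  show "range (cell N k) \<subseteq> insert None (Some ` {\<lfloor>- \<bar>k\<bar> * N\<rfloor>..\<lfloor>\<bar>k\<bar> * N\<rfloor>})"
  proof
    fix j assume "j \<in> range (cell N k)"
    then obtain x where j: "j = cell N k x" by auto
    have "\<bar>k * x\<bar> \<le> \<bar>k\<bar> * N" if "\<bar>x\<bar> < N"
      using that by (auto simp: abs_mult intro!: mult_left_mono)
    then show "j \<in> insert None (Some ` {\<lfloor>- \<bar>k\<bar> * N\<rfloor>..\<lfloor>\<bar>k\<bar> * N\<rfloor>})"
      by (auto simp: j cell_def abs_le_iff intro!: imageI floor_mono)
  qed
qed simp

lemma measurable_cell_density [measurable]: "cell_density N k \<in> borel_measurable borel"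
  unfolding cell_density_def[abs_def] by measurable

lemma cell_density_pos: "k > 0 \<Longrightarrow> 0 < cell_density N k x"
  by (simp add: cell_density_def normal_density_pos)

text \<open>The tail is dominated by the full Gaussian mass, a bounded cell by height
  \<open>k\<close> on a closed interval of length \<open>1 / k\<close>; cells cut off at
  \<open>N\<close> only lose mass.\<close>

lemma nn_integral_cell_density_le:
  assumes "k > 0"
  shows "(\<integral>\<^sup>+ x. ennreal (cell_density N k x * indicator {x. cell N k x = j} x) \<partial>lborel) \<le> 1"
proof (cases j)
  case None
  have "(\<integral>\<^sup>+ x. ennreal (cell_density N k x * indicator {x. cell N k x = j} x) \<partial>lborel)
      \<le> (\<integral>\<^sup>+ x. ennreal (std_normal_density x) \<partial>lborel)"
    by (intro nn_integral_mono ennreal_leI)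
      (auto simp: None cell_def cell_density_def indicator_def)
  also have "\<dots> = 1"
    by (subst nn_integral_eq_integral) auto
  finally show ?thesis .
next
  case (Some i)
  have "(\<integral>\<^sup>+ x. ennreal (cell_density N k x * indicator {x. cell N k x = j} x) \<partial>lborel)
      \<le> (\<integral>\<^sup>+ x. ennreal k * indicator {i / k .. (i + 1) / k} x \<partial>lborel)"
  proof (intro nn_integral_mono)
    fix x
    show "ennreal (cell_density N k x * indicator {x. cell N k x = j} x)
        \<le> ennreal k * indicator {i / k .. (i + 1) / k} x"
    proof (cases "cell N k x = j")
      case True
      then have "\<bar>x\<bar> < N" "\<lfloor>k * x\<rfloor> = i"
        by (auto simp: Some cell_def split: if_splits)
      then have "i \<le> k * x" "k * x \<le> i + 1"
        by linarith+
      with \<open>\<bar>x\<bar> < N\<close> True show ?thesis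
        using assms by (simp add: cell_density_def divide_le_eq le_divide_eq mult.commute)
    qed simp
  qed
  also have "\<dots> = ennreal k * ennreal ((i + 1) / k - i / k)"
    using assms by (simp add: nn_integral_cmult_indicator divide_right_mono)
  also have "\<dots> = ennreal (k * (1 / k))"
    using assms by (subst ennreal_mult) (auto simp: diff_divide_distrib[symmetric])
  finally show ?thesis
    using assms by simp
qed

lemma ln_std_normal_density: "ln (std_normal_density x) = - ln (sqrt (2 * pi)) - x\<^sup>2 / 2"
  by (simp add: std_normal_density_def ln_mult ln_div)

section \<open>Unbounded entropy rates from shrinking cells\<close>

theorem corollary4p21:
  fixes M :: "'a measure" and T :: "'a \<Rightarrow> 'a"
  assumes "invertible_dynamical_system M T"
    and "\<exists>F \<in> AC M T. \<bar>shannon_entropy M T F\<bar> \<noteq> \<infinity>"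
  shows "kolmogorov_sinai_entropy M T = \<infinity>"
proof -
  interpret invertible_dynamical_system M T by (rule assms(1))
  obtain F where F: "F \<in> AC M T" and finite_entropy: "\<bar>shannon_entropy M T F\<bar> \<noteq> \<infinity>"
    using assms(2) by (elim bexE)
  have F_meas [measurable]: "F \<in> borel_measurable M" and F_sq: "integrable M (\<lambda>\<omega>. (F \<omega>)\<^sup>2)"
    and F_ac: "\<And>n. n \<ge> 1 \<Longrightarrow> absolutely_continuous (lebesgue_pow n) (orbit_law M T F n)"
    using F by (auto simp: AC_def)
  obtain r where r: "\<exists>\<^sub>F n in sequentially. ereal r \<le> diff_entropy M T F n / ereal (real n)"
    using frequently_diff_entropy_ge[OF finite_entropy] .
  obtain N where N: "1 / 2 \<le> prob {\<omega>\<in>space M. \<bar>F \<omega>\<bar> < N}"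
    using prob_abs_less_ge_half[OF F_meas] .
  let ?A = "{\<omega>\<in>space M. \<bar>F \<omega>\<bar> < N}"
  define c where "c = ln (sqrt (2 * pi))"
  \<comment> \<open>Bounds the loss caused by the Gaussian tail; it depends neither on
    \<open>B\<close> nor on the cell width.\<close>
  define C where "C = c + (\<integral>\<omega>. (F \<omega>)\<^sup>2 \<partial>M) / 2"
  have "1 \<le> sqrt (2 * pi)"
    using pi_ge_two by simp
  then have c_nonneg: "0 \<le> c"
    unfolding c_def by (rule ln_ge_zero)
  show ?thesis
  proof (rule ereal_top)
    fix B :: real
    \<comment> \<open>Chosen so that \<open>r + l / 2 - C \<ge> B\<close>, with
      \<open>k = exp l\<close>. The factor 2 offsets the probability \<open>1 / 2\<close> of
      \<open>?A\<close>; the absolute value keeps \<open>l\<close> nonnegative.\<close>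
    define l where "l = 2 * \<bar>B + C - r\<bar>"
    let ?w = "cell_density N (exp l)" and ?X = "\<lambda>\<omega>. cell N (exp l) (F \<omega>)"
    have l_nonneg: "0 \<le> l"
      by (simp add: l_def)
    have ln_w: "ln (?w x) = (if \<bar>x\<bar> < N then l else - c - x\<^sup>2 / 2)" for x
      by (simp add: cell_density_def ln_std_normal_density c_def)
    have int_w: "integrable M (\<lambda>\<omega>. ln (?w (F \<omega>)))"
    proof (rule Bochner_Integration.integrable_bound)
      show "integrable M (\<lambda>\<omega>. l + c + (F \<omega>)\<^sup>2 / 2)"
        using F_sq by simp
      show "AE \<omega> in M. norm (ln (?w (F \<omega>))) \<le> norm (l + c + (F \<omega>)\<^sup>2 / 2)"
      proof (intro AE_I2)
        fix \<omega>
        have "0 \<le> (F \<omega>)\<^sup>2 / 2" by simp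
        with l_nonneg c_nonneg show "norm (ln (?w (F \<omega>))) \<le> norm (l + c + (F \<omega>)\<^sup>2 / 2)"
          unfolding ln_w real_norm_def by (smt (verit))
      qed
    qed measurable
    have "l / 2 - C \<le> l * prob ?A - C"
      using mult_left_mono[OF N l_nonneg] by simp
    also have "\<dots> = (\<integral>\<omega>. l * indicator ?A \<omega> - (c + (F \<omega>)\<^sup>2 / 2) \<partial>M)"
      using F_sq by (simp add: C_def prob_space emeasure_eq_measure Int_absorb2)
    \<comment> \<open>The integrands agree on the tail; on the cells a nonnegative amount is
      dropped.\<close>
    also have "\<dots> \<le> (\<integral>\<omega>. ln (?w (F \<omega>)) \<partial>M)"
    proof (rule integral_mono[OF _ int_w])
      show "integrable M (\<lambda>\<omega>. l * indicator ?A \<omega> - (c + (F \<omega>)\<^sup>2 / 2))"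
        using F_sq by (simp add: emeasure_eq_measure)
      show "l * indicator ?A \<omega> - (c + (F \<omega>)\<^sup>2 / 2) \<le> ln (?w (F \<omega>))" if "\<omega> \<in> space M" for \<omega>
        using c_nonneg that by (auto simp: ln_w intro: order_trans[OF _ zero_le_power2])
    qed
    finally have "l / 2 - C \<le> (\<integral>\<omega>. ln (?w (F \<omega>)) \<partial>M)" .
    moreover have "B + C - r \<le> l / 2"
      by (simp add: l_def)
    ultimately have w_ge: "B \<le> r + (\<integral>\<omega>. ln (?w (F \<omega>)) \<partial>M)"
      by linarith
    have "finite (?X ` space M)"
      by (rule finite_subset[OF _ finite_range_cell[of N "exp l"]]) auto
    then have X: "simple_function M ?X"
      by (simp add: simple_function_eq_measurable)
    have rate_ge: "ereal B \<le> ereal (level_entropy M (itinerary T ?X n) / n)"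
      if n: "n \<ge> 1" and ge: "ereal r \<le> diff_entropy M T F n / ereal (real n)" for n
    proof -
      let ?e = "\<integral>\<omega>. ln (?w (F \<omega>)) \<partial>M" and ?h = "level_entropy M (itinerary T ?X n)"
      have "ereal r \<le> ereal (?h - n * ?e) / ereal (real n)"
        using ge diff_entropy_le[OF F_ac[OF n] F_meas measurable_cell finite_range_cell
            measurable_cell_density cell_density_pos nn_integral_cell_density_le int_w] n
        by (elim order_trans) (intro ereal_divide_right_mono, auto)
      then have "r \<le> (?h - n * ?e) / n"
        using n by simp
      also have "\<dots> = ?h / n - ?e"
        using n by (simp add: field_simps)
      finally show ?thesis
        using w_ge by simp
    qed
    have "\<exists>\<^sub>F n in sequentially. ereal B \<le> ereal (level_entropy M (itinerary T ?X n) / n)"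
      using frequently_eventually_frequently[OF r eventually_ge_at_top[of 1]]
      by (rule frequently_elim1) (use rate_ge in auto)
    \<comment> \<open>A rate below \<open>B\<close> would eventually force the convergent sequence
      below \<open>B\<close>, against the bound that holds infinitely often.\<close>
    then have "ereal B \<le> partition_entropy_rate M T (level_sets M ?X)"
      using order_tendstoD(2)[OF partition_entropy_rate_level_sets[OF X], of "ereal B"]
      by (auto simp: frequently_def not_le intro: leI)
    also have "\<dots> \<le> kolmogorov_sinai_entropy M T"
      unfolding kolmogorov_sinai_entropy_def
      using finite_measurable_partition_level_sets[OF X] by (intro SUP_upper) auto
    finally show "ereal B \<le> kolmogorov_sinai_entropy M T" .
  qed
qed

end
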